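(* Let $X$ be a stochastic process, $\phi$ an STL formula and $t\in T$, and let $Z:=-\rho^\phi(X,t)$ be the associated real-valued random variable, with cumulative distribution function $F_Z$. Assume that $F_Z$ is continuous, and let $\delta\in(0,1)$ and $\beta\in(0,1)$. Let $X^1,\dots,X^N$ ($N\ge 1$) be independent copies of $X$, let $Z^i:=-\rho^\phi(X^i,t)$ (so that $Z^1,\dots,Z^N$ are independent and distributed as $Z$), and let $\mathcal{Z}:=(Z^1,\dots,Z^N)$. Then, with probability at least $1-\delta$, $$\underline{VaR}_\beta(\mathcal{Z},\delta)\le VaR_\beta(Z)\le \overline{VaR}_\beta(\mathcal{Z},\delta).$$
   Context: Value-at-risk: $VaR_\beta(Z):=\inf\{\alpha\in\mathbb{R}: F_Z(\alpha)\ge\beta\}$. Empirical CDF: $\widehat F(\alpha,\mathcal{Z}):=\frac1N\sum_{i=1}^N\mathbb{I}(Z^i\le\alpha)$, where $\mathbb{I}$ is the $0/1$ indicator. Bounds: $$\overline{VaR}_\beta(\mathcal{Z},\delta):=\inf\Big\{\alpha\in\mathbb{R}:\widehat F(\alpha,\mathcal{Z})-\sqrt{\tfrac{\ln(2/\delta)}{2N}}\ge\beta\Big\},\qquad \underline{VaR}_\beta(\mathcal{Z},\delta):=\inf\Big\{\alpha\in\mathbb{R}:\widehat F(\alpha,\mathcal{Z})+\sqrt{\tfrac{\ln(2/\delta)}{2N}}\ge\beta\Big\},$$ with infima taken in the extended reals ($\inf\emptyset=\infty$, $\inf\mathbb{R}=-\infty$). Stochastic process: a function $X:T\times\Omega\to\mathbb{R}^n$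 on a probability space $(\Omega,\mathcal{F},P)$, $T=\mathbb{Z}$ or $T=\mathbb{R}$, with $X(t,\cdot)$ measurable for each $t$. $\rho^\phi(X,t)$ denotes $\omega\mapsto\rho^\phi(X(\cdot,\omega),t)$, which is assumed to be a real-valued random variable. STL. A predicate is $\mu:\mathbb{R}^n\to\{\top,\bot\}$ with $O^\mu:=\mu^{-1}(\top)$, $O^{\neg\mu}:=\mathbb{R}^n\setminus O^\mu$, both assumed nonempty and Borel. STL formulas: $\phi::=\top\mid\mu\mid\neg\phi\mid\phi'\wedge\phi''\mid\phi'U_I\phi''\mid\phi'\underline U_I\phi''$ with intervals $I\subseteq\mathbb{R}_{\ge0}$. For a metric $d$ on $\mathbb{R}^n$ let $\bar d(\zeta,S):=\inf_{\zeta'\in S}d(\zeta,\zeta')$. Robust semantics of a signal $x:T\to\mathbb{R}^n$: $\rho^\top(x,t)=\infty$; $\rho^\mu(x,t)=\bar d(x(t),\mathrm{cl}(O^{\neg\mu}))$ if $x(t)\in O^\mu$, else $-\bar d(x(t),\mathrm{cl}(O^\mu))$; $\rho^{\neg\phi}=-\rho^\phi$; $\rho^{\phi'\wedge\phi''}=\min(\rho^{\phi'},\rho^{\phi''})$; $\rho^{\phi'U_I\phi''}(x,t)=\sup_{t''\in(t\oplus I)\cap T}\min\big(\rho^{\phi''}(x,t''),\inf_{t'\in(t,t'')\cap T}\rho^{\phi'}(x,t')\big)$; $\rho^{\phi'\underline U_I\phi''}(x,t)=\sup_{t''\in(t\ominus I)\cap T}\min\big(\rho^{\phi''}(x,t''),\inf_{t'\in(t'',t)\cap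 T}\rho^{\phi'}(x,t')\big)$, where $t\oplus I=\{t+s:s\in I\}$, $t\ominus I=\{t-s:s\in I\}$. (In continuous time the open intervals $(t,t'')$, $(t'',t)$ may be replaced by $[t,t'']$, $[t'',t]$, the non-strict matching until operators.) *)

theory Defs
  imports "HOL-Probability.Probability"
begin

text \<open>All infima are taken in \<^typ>\<open>ereal\<close>, so that the infimum of the empty set is
  \<open>\<infinity>\<close> and that of the whole real line is \<open>-\<infinity>\<close>.\<close>

definition VaR :: "real \<Rightarrow> 'w measure \<Rightarrow> ('w \<Rightarrow> real) \<Rightarrow> ereal" where
  "VaR \<beta> M Z = Inf (ereal ` {\<alpha>. cdf (distr M borel Z) \<alpha> \<ge> \<beta>})"

text \<open>A sample of size \<open>N\<close> is \<open>z 1, \<dots>, z N\<close>.\<close>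

definition emp_cdf :: "nat \<Rightarrow> (nat \<Rightarrow> real) \<Rightarrow> real \<Rightarrow> real" where
  "emp_cdf N z \<alpha> = (1 / real N) * (\<Sum>i = 1..N. of_bool (z i \<le> \<alpha>))"

definition VaR_upper :: "real \<Rightarrow> nat \<Rightarrow> (nat \<Rightarrow> real) \<Rightarrow> real \<Rightarrow> ereal" where
  "VaR_upper \<beta> N z \<delta> =
     Inf (ereal ` {\<alpha>. emp_cdf N z \<alpha> - sqrt (ln (2 / \<delta>) / (2 * real N)) \<ge> \<beta>})"

definition VaR_lower :: "real \<Rightarrow> nat \<Rightarrow> (nat \<Rightarrow> real) \<Rightarrow> real \<Rightarrow> ereal" where
  "VaR_lower \<beta> N z \<delta> =
     Inf (ereal ` {\<alpha>. emp_cdf N z \<alpha> + sqrt (ln (2 / \<delta>) / (2 * real N)) \<ge> \<beta>})"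

datatype 'a stl =
    Top
  | Pred "'a \<Rightarrow> bool"
  | Neg "'a stl"
  | Conj "'a stl" "'a stl"
  | Until "real set" "'a stl" "'a stl"
  | Since "real set" "'a stl" "'a stl"

primrec wf_stl :: "'a::topological_space stl \<Rightarrow> bool" where
  "wf_stl Top \<longleftrightarrow> True"
| "wf_stl (Pred \<mu>) \<longleftrightarrow> Collect \<mu> \<noteq> {} \<and> - Collect \<mu> \<noteq> {} \<and>
     Collect \<mu> \<in> sets borel \<and> - Collect \<mu> \<in> sets borel"
| "wf_stl (Neg f) \<longleftrightarrow> wf_stl f"
| "wf_stl (Conj f g) \<longleftrightarrow> wf_stl f \<and> wf_stl g"
| "wf_stl (Until I f g) \<longleftrightarrow> is_interval I \<and> I \<subseteq> {0..} \<and> wf_stl f \<and> wf_stl g"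
| "wf_stl (Since I f g) \<longleftrightarrow> is_interval I \<and> I \<subseteq> {0..} \<and> wf_stl f \<and> wf_stl g"

definition dbar :: "('a \<Rightarrow> 'a \<Rightarrow> real) \<Rightarrow> 'a \<Rightarrow> 'a set \<Rightarrow> ereal" where
  "dbar d z S = (INF z'\<in>S. ereal (d z z'))"

text \<open>The two readings of the until operators: strict matching uses the open interval between
  the two time points, non-strict matching the closed one.\<close>

datatype matching = Strict | Nonstrict

fun between :: "matching \<Rightarrow> real \<Rightarrow> real \<Rightarrow> real set" where
  "between Strict a b = {a<..<b}"
| "between Nonstrict a b = {a..b}"

text \<open>The time domain \<open>T\<close> is a set of reals (\<^term>\<open>\<int>\<close> or \<^term>\<open>UNIV\<close>), and a signal
  \<open>T \<rightarrow> \<real>\<^sup>n\<close> is a function on the reals whose values outside \<open>T\<close> never matter: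
  for \<open>t \<in> T\<close> the robustness at \<open>t\<close> only depends on the signal on \<open>T\<close>.\<close>

primrec rob :: "('a::topological_space \<Rightarrow> 'a \<Rightarrow> real) \<Rightarrow> real set \<Rightarrow> matching \<Rightarrow> 'a stl \<Rightarrow>
    (real \<Rightarrow> 'a) \<Rightarrow> real \<Rightarrow> ereal" where
  "rob d T m Top = (\<lambda>x t. \<infinity>)"
| "rob d T m (Pred \<mu>) = (\<lambda>x t.
     if \<mu> (x t) then dbar d (x t) (closure (- Collect \<mu>))
     else - dbar d (x t) (closure (Collect \<mu>)))"
| "rob d T m (Neg f) = (\<lambda>x t. - rob d T m f x t)"
| "rob d T m (Conj f g) = (\<lambda>x t. min (rob d T m f x t) (rob d T m g x t))"
| "rob d T m (Until I f g) = (\<lambda>x t.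
     SUP t''\<in>(\<lambda>s. t + s) ` I \<inter> T.
       min (rob d T m g x t'') (INF t'\<in>between m t t'' \<inter> T. rob d T m f x t'))"
| "rob d T m (Since I f g) = (\<lambda>x t.
     SUP t''\<in>(\<lambda>s. t - s) ` I \<inter> T.
       min (rob d T m g x t'') (INF t'\<in>between m t'' t \<inter> T. rob d T m f x t'))"

definition stochastic_process ::
  "'w measure \<Rightarrow> real set \<Rightarrow> (real \<Rightarrow> 'w \<Rightarrow> 'a::topological_space) \<Rightarrow> bool" where
  "stochastic_process M T X \<longleftrightarrow> prob_space M \<and> (\<forall>s\<in>T. X s \<in> borel_measurable M)"

text \<open>\<open>rob_rv d T m \<phi> X t\<close> is \<open>\<omega> \<mapsto> \<rho>(X(\<cdot>,\<omega>),t)\<close>, and \<open>loss d T m \<phi> X t\<close> is its negative as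
  a real-valued function; the coercion to the reals is only meaningful where the robustness is
  finite. If this is everywhere the case for \<open>X\<close>, then it is almost surely the case for copies
  of \<open>X\<close> in the sense of \<open>independent_copies\<close> below.\<close>

definition rob_rv :: "('a::topological_space \<Rightarrow> 'a \<Rightarrow> real) \<Rightarrow> real set \<Rightarrow> matching \<Rightarrow> 'a stl \<Rightarrow>
    (real \<Rightarrow> 'w \<Rightarrow> 'a) \<Rightarrow> real \<Rightarrow> 'w \<Rightarrow> ereal" where
  "rob_rv d T m \<phi> X t \<omega> = rob d T m \<phi> (\<lambda>s. X s \<omega>) t"

definition loss :: "('a::topological_space \<Rightarrow> 'a \<Rightarrow> real) \<Rightarrow> real set \<Rightarrow> matching \<Rightarrow> 'a stl \<Rightarrow>
    (real \<Rightarrow> 'w \<Rightarrow> 'a) \<Rightarrow> real \<Rightarrow> 'w \<Rightarrow> real" where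
  "loss d T m \<phi> X t \<omega> = real_of_ereal (- rob_rv d T m \<phi> X t \<omega>)"

text \<open>Equality in law and independence of processes refer to a \<open>\<sigma>\<close>-algebra on path space. In
  discrete time the cylinder \<open>\<sigma>\<close>-algebra is the right one. In continuous time robustness is an
  uncountable supremum, hence in general not a measurable function of the path with respect to
  the cylinder \<open>\<sigma>\<close>-algebra, and processes with the same finite-dimensional distributions may have
  differently distributed robustness. Therefore the path space carries the smallest
  \<open>\<sigma>\<close>-algebra that makes the coordinates and the robustness measurable. In discrete time, for
  well-formed formulas and a metric that is continuous for the usual topology, this is the
  cylinder \<open>\<sigma>\<close>-algebra, see lemma \<open>sets_path_space_discrete\<close> below; and a process whose
  robustness is a random variable is always a random element of the path space, see lemma
  \<open>measurable_sample_path\<close>.\<close>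

definition cylinders :: "real set \<Rightarrow> (real \<Rightarrow> 'a::topological_space) set set" where
  "cylinders T = {{x. x s \<in> B} | s B. s \<in> T \<and> B \<in> sets borel}"

definition path_space :: "('a::topological_space \<Rightarrow> 'a \<Rightarrow> real) \<Rightarrow> real set \<Rightarrow> matching \<Rightarrow>
    'a stl \<Rightarrow> real \<Rightarrow> (real \<Rightarrow> 'a) measure" where
  "path_space d T m \<phi> t =
     sigma UNIV (cylinders T \<union> {{x. rob d T m \<phi> x t \<in> B} | B. B \<in> sets borel})"

definition sample_path :: "(real \<Rightarrow> 'w \<Rightarrow> 'a) \<Rightarrow> 'w \<Rightarrow> real \<Rightarrow> 'a" where
  "sample_path X \<omega> = (\<lambda>s. X s \<omega>)"

text \<open>\<open>Y 1, \<dots>, Y N\<close>, defined on \<open>M'\<close>, are independent copies of \<open>X\<close>, defined on \<open>M\<close>, as random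
  elements of the path space \<open>S\<close>. (Measurability of \<open>sample_path (Y i)\<close> is part of \<open>indep_vars\<close>.)\<close>

definition independent_copies :: "(real \<Rightarrow> 'a) measure \<Rightarrow> 'w measure \<Rightarrow> (real \<Rightarrow> 'w \<Rightarrow> 'a) \<Rightarrow>
    'v measure \<Rightarrow> (nat \<Rightarrow> real \<Rightarrow> 'v \<Rightarrow> 'a) \<Rightarrow> nat \<Rightarrow> bool" where
  "independent_copies S M X M' Y N \<longleftrightarrow>
     prob_space.indep_vars M' (\<lambda>i. S) (\<lambda>i. sample_path (Y i)) {1..N} \<and>
     (\<forall>i\<in>{1..N}. distr M' S (sample_path (Y i)) = distr M S (sample_path X))"

lemma measurable_sample_path:
  assumes "\<And>s. s \<in> T \<Longrightarrow> X s \<in> borel_measurable M"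
    and "rob_rv d T m \<phi> X t \<in> borel_measurable M"
  shows "sample_path X \<in> measurable M (path_space d T m \<phi> t)"
  unfolding path_space_def
proof (rule measurable_measure_of)
  fix A assume "A \<in> cylinders T \<union> {{x. rob d T m \<phi> x t \<in> B} | B. B \<in> sets borel}"
  then consider s B where "s \<in> T" "B \<in> sets borel" "A = {x. x s \<in> B}"
    | B where "B \<in> sets borel" "A = {x. rob d T m \<phi> x t \<in> B}"
    unfolding cylinders_def by blast
  then show "sample_path X -` A \<inter> space M \<in> sets M"
  proof cases
    case 1
    then have "X s -` B \<inter> space M \<in> sets M"
      using assms(1) measurable_sets by blast
    then show ?thesis
      using 1 by (simp add: sample_path_def vimage_def)
  next
    case 2
    then have "rob_rv d T m \<phi> X t -` B \<inter> space M \<in> sets M"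
      using assms(2) measurable_sets by blast
    then show ?thesis
      using 2 by (simp add: sample_path_def rob_rv_def vimage_def)
  qed
qed auto

lemma borel_measurable_dbar:
  fixes d :: "'a::topological_space \<Rightarrow> 'a \<Rightarrow> real"
  assumes "\<And>y. continuous_on UNIV (\<lambda>z. d z y)"
  shows "(\<lambda>z. dbar d z S) \<in> borel_measurable borel"
proof (rule borel_measurableI_less)
  fix a :: ereal
  have "{z. dbar d z S < a} = (\<Union>y\<in>S. {z. ereal (d z y) < a})"
    by (auto simp: dbar_def INF_less_iff)
  moreover have "open {z. ereal (d z y) < a}" for y
    by (intro open_Collect_less continuous_intros assms)
  ultimately have "open {z. dbar d z S < a}"
    by auto
  then show "{z \<in> space borel. dbar d z S < a} \<in> sets borel"
    by simp
qed

lemma borel_measurable_rob_discrete: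
  fixes d :: "'a::topological_space \<Rightarrow> 'a \<Rightarrow> real"
  assumes d: "\<And>y. continuous_on UNIV (\<lambda>z. d z y)"
  shows "wf_stl \<phi> \<Longrightarrow> t \<in> \<int> \<Longrightarrow>
    (\<lambda>x. rob d \<int> m \<phi> x t) \<in> borel_measurable (sigma UNIV (cylinders \<int>))"
proof (induction \<phi> arbitrary: t)
  case (Pred \<mu>)
  let ?S = "sigma UNIV (cylinders \<int>) :: (real \<Rightarrow> 'a) measure"
  have ev: "(\<lambda>x. x t) \<in> measurable ?S borel"
  proof (rule measurableI)
    fix B :: "'a set" assume "B \<in> sets borel"
    then have "{x. x t \<in> B} \<in> cylinders \<int>"
      using Pred by (auto simp: cylinders_def)
    then show "(\<lambda>x. x t) -` B \<inter> space ?S \<in> sets ?S"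
      by (simp add: vimage_def)
  qed simp
  have "(\<lambda>z. if z \<in> Collect \<mu> then dbar d z (closure (- Collect \<mu>))
      else - dbar d z (closure (Collect \<mu>))) \<in> borel_measurable borel"
    using Pred borel_measurable_dbar[OF d] by (intro measurable_If_set) auto
  from measurable_compose[OF ev this] show ?case
    by simp
next
  case (Until I f g)
  have "countable (\<int> :: real set)"
    by (simp add: Ints_def)
  then show ?case
    using Until by (auto intro!: borel_measurable_SUP borel_measurable_INF borel_measurable_min)
next
  case (Since I f g)
  have "countable (\<int> :: real set)"
    by (simp add: Ints_def)
  then show ?case
    using Since by (auto intro!: borel_measurable_SUP borel_measurable_INF borel_measurable_min)
qed auto

lemma sets_path_space_discrete:
  fixes d :: "'a::topological_space \<Rightarrow> 'a \<Rightarrow> real"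
  assumes "\<And>y. continuous_on UNIV (\<lambda>z. d z y)" "wf_stl \<phi>" "t \<in> \<int>"
  shows "sets (path_space d \<int> m \<phi> t) = sets (sigma UNIV (cylinders \<int>))"
proof -
  let ?C = "cylinders \<int> :: (real \<Rightarrow> 'a) set set"
  let ?R = "{{x. rob d \<int> m \<phi> x t \<in> B} | B. B \<in> sets borel}"
  have "?R \<subseteq> sigma_sets UNIV ?C"
    using measurable_sets[OF borel_measurable_rob_discrete[OF assms]]
    by (auto simp: vimage_def)
  then have "sigma_sets UNIV (?C \<union> ?R) = sigma_sets UNIV ?C"
    by (intro sigma_sets_eqI) (auto intro: sigma_sets.Basic)
  then show ?thesis
    by (simp add: path_space_def)
qed

end

theory Submission
  imports Defs
begin

text \<open>Since \<open>F\<^sub>Z\<close> is continuous, \<open>v = VaR\<^sub>\<beta>(Z)\<close> is a real number with \<open>F\<^sub>Z(v) = \<beta>\<close>. By monotonicity of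
  the empirical distribution function, the lower bound can only exceed \<open>v\<close> if the empirical
  distribution function at \<open>v\<close> is below \<open>\<beta> - \<epsilon>\<close>, and the upper bound can only be less than \<open>v\<close> if it
  is at least \<open>\<beta> + \<epsilon>\<close>, where \<open>\<epsilon> = sqrt (ln (2 / \<delta>) / (2 N))\<close>. So a deviation bound at the single
  point \<open>v\<close> suffices, and the two-sided Hoeffding inequality for the indicators of \<open>Z\<^sup>i \<le> v\<close> gives
  the failure probability \<open>2 exp (- 2 N \<epsilon>\<^sup>2) = \<delta>\<close>. No uniform bound over all \<open>\<alpha>\<close> is needed.\<close>

lemma mono_emp_cdf: "mono (emp_cdf N z)"
  unfolding emp_cdf_def
  by (intro monoI mult_left_mono sum_mono) (auto intro: order_trans)

lemma emp_cdf_measurable [measurable]: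
  assumes "\<And>i. i \<in> {1..N} \<Longrightarrow> Z i \<in> borel_measurable M"
  shows "(\<lambda>\<omega>. emp_cdf N (\<lambda>i. Z i \<omega>) \<alpha>) \<in> borel_measurable M"
  unfolding emp_cdf_def using assms
  by (intro borel_measurable_times borel_measurable_const borel_measurable_sum) measurable

text \<open>Quantifying over the rationals turns events about infima of random upper sets into countable
  intersections.\<close>

lemma Inf_upper_level_le_iff:
  fixes G :: "real \<Rightarrow> real"
  assumes "mono G"
  shows "Inf (ereal ` {\<alpha>. c \<le> G \<alpha>}) \<le> ereal v \<longleftrightarrow> (\<forall>q\<in>\<rat>. v < q \<longrightarrow> c \<le> G q)"
proof
  assume le: "Inf (ereal ` {\<alpha>. c \<le> G \<alpha>}) \<le> ereal v"
  show "\<forall>q\<in>\<rat>. v < q \<longrightarrow> c \<le> G q"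
  proof (intro ballI impI)
    fix q assume "v < q"
    \<comment> \<open>The infimum need not be attained, as \<open>G\<close> may jump. A strict bound
      by \<open>q\<close> yields an actual member of the level set below \<open>q\<close>.\<close>
    with le have "Inf (ereal ` {\<alpha>. c \<le> G \<alpha>}) < ereal q"
      by (meson ereal_less(2) less_ereal.simps(1) order_le_less_trans)
    then obtain \<alpha> where "c \<le> G \<alpha>" "\<alpha> < q"
      by (auto simp: Inf_less_iff)
    then show "c \<le> G q"
      using monoD[OF assms, of \<alpha> q] by linarith
  qed
next
  assume rat: "\<forall>q\<in>\<rat>. v < q \<longrightarrow> c \<le> G q"
  show "Inf (ereal ` {\<alpha>. c \<le> G \<alpha>}) \<le> ereal v"
  proof (rule ccontr)
    assume "\<not> ?thesis"
    then have "ereal v < Inf (ereal ` {\<alpha>. c \<le> G \<alpha>})"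
      by (simp only: not_le)
    \<comment> \<open>The infimum may be \<open>\<infinity>\<close>, so a real \<open>r\<close> is
      first inserted strictly between \<open>v\<close> and it.\<close>
    then obtain r where r: "v < r" "ereal r < Inf (ereal ` {\<alpha>. c \<le> G \<alpha>})"
      using ereal_dense2 less_ereal.simps(1) by metis
    then obtain q where q: "q \<in> \<rat>" "v < q" "q < r"
      using Rats_dense_in_real[of v r] by auto
    then have "Inf (ereal ` {\<alpha>. c \<le> G \<alpha>}) \<le> ereal q"
      using rat by (intro Inf_lower) auto
    also have "\<dots> < ereal r"
      using q by simp
    finally show False
      using r by simp
  qed
qed

text \<open>A member of the level set below \<open>v\<close> can be moved up, by monotonicity, to a
  rational still below \<open>v\<close>. If the level set is empty, the infimum is
  \<open>\<infinity>\<close> and both sides hold.\<close>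

lemma le_Inf_upper_level_iff:
  fixes G :: "real \<Rightarrow> real"
  assumes "mono G"
  shows "ereal v \<le> Inf (ereal ` {\<alpha>. c \<le> G \<alpha>}) \<longleftrightarrow> (\<forall>q\<in>\<rat>. q < v \<longrightarrow> G q < c)"
proof
  assume "ereal v \<le> Inf (ereal ` {\<alpha>. c \<le> G \<alpha>})"
  then have "v \<le> \<alpha>" if "c \<le> G \<alpha>" for \<alpha>
    using that by (simp add: le_Inf_iff)
  then show "\<forall>q\<in>\<rat>. q < v \<longrightarrow> G q < c"
    by (meson not_le)
next
  assume rat: "\<forall>q\<in>\<rat>. q < v \<longrightarrow> G q < c"
  have "v \<le> \<alpha>" if "c \<le> G \<alpha>" for \<alpha>
  proof (rule ccontr)
    assume "\<not> v \<le> \<alpha>"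
    then obtain q where "q \<in> \<rat>" "\<alpha> < q" "q < v"
      using Rats_dense_in_real[of \<alpha> v] by auto
    then show False
      using rat that monoD[OF assms, of \<alpha> q] by fastforce
  qed
  then show "ereal v \<le> Inf (ereal ` {\<alpha>. c \<le> G \<alpha>})"
    by (auto simp: le_Inf_iff)
qed

lemma VaR_lower_le_iff:
  "VaR_lower \<beta> N z \<delta> \<le> ereal v \<longleftrightarrow>
     (\<forall>q\<in>\<rat>. v < q \<longrightarrow> \<beta> \<le> emp_cdf N z q + sqrt (ln (2 / \<delta>) / (2 * real N)))"
  unfolding VaR_lower_def
  by (rule Inf_upper_level_le_iff) (use mono_emp_cdf[of N z] in \<open>auto simp: mono_def\<close>)

lemma le_VaR_upper_iff:
  "ereal v \<le> VaR_upper \<beta> N z \<delta> \<longleftrightarrow>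
     (\<forall>q\<in>\<rat>. q < v \<longrightarrow> emp_cdf N z q - sqrt (ln (2 / \<delta>) / (2 * real N)) < \<beta>)"
  unfolding VaR_upper_def
  by (rule le_Inf_upper_level_iff) (use mono_emp_cdf[of N z] in \<open>auto simp: mono_def\<close>)

text \<open>The limits of the CDF and the intermediate value theorem give a point of value \<beta>.
  The level set is thus nonempty, bounded below and, by continuity, closed, so it contains its
  infimum.\<close>

lemma VaR_continuous_cdf:
  assumes "prob_space M" and Z: "Z \<in> borel_measurable M"
    and cont: "continuous_on UNIV (cdf (distr M borel Z))"
    and \<beta>: "0 < \<beta>" "\<beta> < 1"
  obtains v where "VaR \<beta> M Z = ereal v" "cdf (distr M borel Z) v = \<beta>"
proof -
  interpret M: prob_space M by fact
  interpret D: real_distribution "distr M borel Z"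
    using Z by (rule M.real_distribution_distr)
  let ?F = "cdf (distr M borel Z)"
  let ?A = "{\<alpha>. \<beta> \<le> ?F \<alpha>}"
  have "eventually (\<lambda>x. ?F x < \<beta>) at_bot"
    using D.cdf_lim_at_bot \<beta>(1) by (rule order_tendstoD)
  then obtain a where a: "?F a < \<beta>"
    by (auto simp: eventually_at_bot_linorder)
  have "eventually (\<lambda>x. \<beta> < ?F x) at_top"
    using D.cdf_lim_at_top_prob \<beta>(2) by (rule order_tendstoD)
  then obtain b where b: "\<beta> < ?F b"
    by (auto simp: eventually_at_top_linorder)
  have "a \<le> b"
    using a b D.cdf_nondecreasing[of b a] by (cases "a \<le> b") auto
  then obtain x where x: "?F x = \<beta>"
    using IVT'[of ?F a \<beta> b] a b continuous_on_subset[OF cont] by auto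
  have bdd: "bdd_below ?A"
  proof (rule bdd_belowI)
    fix y assume "y \<in> ?A"
    then show "a \<le> y"
      using a D.cdf_nondecreasing[of y a] by (cases "a \<le> y") auto
  qed
  have "closed ?A"
    by (intro closed_Collect_le continuous_intros cont)
  then have "Inf ?A \<in> ?A"
    using x bdd by (intro closed_contains_Inf) auto
  \<comment> \<open>Comparison with \<open>x\<close>, where the value is exactly \<beta>, excludes a
    value above \<beta> at the infimum.\<close>
  moreover have "?F (Inf ?A) \<le> ?F x"
    using x bdd by (intro D.cdf_nondecreasing cInf_lower) auto
  ultimately have "?F (Inf ?A) = \<beta>"
    using x by auto
  moreover have "VaR \<beta> M Z = ereal (Inf ?A)"
    unfolding VaR_def using x bdd by (subst ereal_Inf') auto
  ultimately show ?thesis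
    using that by blast
qed

text \<open>Scaled by \<open>N\<close>, the deviation is that of a sum of independent
  \<open>[0,1]\<close>-valued indicators from its mean \<open>N * p\<close>.\<close>

lemma (in prob_space) emp_cdf_deviation:
  assumes indep: "indep_vars (\<lambda>_. borel) Z {1..N}" and N: "N \<ge> 1"
    and p: "\<And>i. i \<in> {1..N} \<Longrightarrow> cdf (distr M borel (Z i)) v = p"
    and \<epsilon>: "\<epsilon> \<ge> 0"
  shows "prob {\<omega>\<in>space M. \<epsilon> \<le> \<bar>emp_cdf N (\<lambda>i. Z i \<omega>) v - p\<bar>} \<le> 2 * exp (- 2 * real N * \<epsilon>\<^sup>2)"
proof -
  let ?B = "\<lambda>i \<omega>. of_bool (Z i \<omega> \<le> v) :: real"
  have rv: "random_variable borel (Z i)" if "i \<in> {1..N}" for i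
    using indep that by (auto simp: indep_vars_def)
  have exp: "expectation (?B i) = p" if i: "i \<in> {1..N}" for i
  proof -
    have "expectation (?B i) = expectation (indicator {\<omega>\<in>space M. Z i \<omega> \<le> v})"
      by (intro Bochner_Integration.integral_cong) (auto simp: indicator_def)
    also have "\<dots> = prob {\<omega>\<in>space M. Z i \<omega> \<le> v}"
      using rv[OF i] by simp
    also have "\<dots> = cdf (distr M borel (Z i)) v"
      using rv[OF i] by (auto simp: cdf_def measure_distr intro!: arg_cong[where f = prob])
    finally show ?thesis
      using p[OF i] by simp
  qed
  have "indep_vars (\<lambda>_. borel) ?B {1..N}"
    by (rule indep_vars_compose2[OF indep, where Y = "\<lambda>_ z. of_bool (z \<le> v)"]) simp
  then interpret Hoeffding_ineq M "{1..N}" ?B "\<lambda>_. 0" "\<lambda>_. 1" "real N * p"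
    by unfold_locales (auto simp: exp)
  have "(\<epsilon> \<le> \<bar>emp_cdf N (\<lambda>i. Z i \<omega>) v - p\<bar>) =
      (real N * \<epsilon> \<le> \<bar>(\<Sum>i=1..N. ?B i \<omega>) - real N * p\<bar>)" for \<omega>
  proof -
    have "(\<Sum>i=1..N. ?B i \<omega>) - real N * p = real N * (emp_cdf N (\<lambda>i. Z i \<omega>) v - p)"
      using N by (simp add: emp_cdf_def right_diff_distrib)
    then show ?thesis
      using N by (simp add: abs_mult)
  qed
  then have "prob {\<omega>\<in>space M. \<epsilon> \<le> \<bar>emp_cdf N (\<lambda>i. Z i \<omega>) v - p\<bar>} =
      prob {\<omega>\<in>space M. real N * \<epsilon> \<le> \<bar>(\<Sum>i=1..N. ?B i \<omega>) - real N * p\<bar>}"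
    by simp
  also have "\<dots> \<le> 2 * exp (- 2 * (real N * \<epsilon>)\<^sup>2 / (\<Sum>i=1..N. (1 - 0)\<^sup>2))"
    using N \<epsilon> by (intro Hoeffding_ineq_abs_ge) auto
  \<comment> \<open>The \<open>N\<close> squared ranges sum to \<open>N\<close>, which cancels one
    factor of \<open>(real N * \<epsilon>)\<^sup>2\<close>.\<close>
  also have "- 2 * (real N * \<epsilon>)\<^sup>2 / (\<Sum>i=1..N. (1 - 0)\<^sup>2) = - 2 * real N * \<epsilon>\<^sup>2"
    using N by (simp add: power2_eq_square)
  finally show ?thesis .
qed

text \<open>The probabilistic core, free of processes and formulas. The sample and the reference
  variable may live on different spaces; only their laws are linked.\<close>

theorem (in prob_space) VaR_confidence_bounds:
  assumes indep: "indep_vars (\<lambda>_. borel) Z {1..N}" and N: "N \<ge> 1"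
    and M0: "prob_space M0" and Z0: "Z0 \<in> borel_measurable M0"
    and distr: "\<And>i. i \<in> {1..N} \<Longrightarrow> distr M borel (Z i) = distr M0 borel Z0"
    and cont: "continuous_on UNIV (cdf (distr M0 borel Z0))"
    and \<delta>: "0 < \<delta>" "\<delta> < 1" and \<beta>: "0 < \<beta>" "\<beta> < 1"
  shows "prob {\<omega>\<in>space M. VaR_lower \<beta> N (\<lambda>i. Z i \<omega>) \<delta> \<le> VaR \<beta> M0 Z0 \<and>
      VaR \<beta> M0 Z0 \<le> VaR_upper \<beta> N (\<lambda>i. Z i \<omega>) \<delta>} \<ge> 1 - \<delta>"
proof -
  obtain v where v: "VaR \<beta> M0 Z0 = ereal v" "cdf (distr M0 borel Z0) v = \<beta>"
    using VaR_continuous_cdf[OF M0 Z0 cont \<beta>] .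
  define \<epsilon> where "\<epsilon> = sqrt (ln (2 / \<delta>) / (2 * real N))"
  have ln_pos: "0 < ln (2 / \<delta>)"
    using \<delta> by simp
  have "2 * exp (- 2 * real N * \<epsilon>\<^sup>2) = 2 * exp (- ln (2 / \<delta>))"
    using N ln_pos by (simp add: \<epsilon>_def)
  also have "\<dots> = \<delta>"
    using \<delta> by (simp add: exp_minus)
  finally have tail: "2 * exp (- 2 * real N * \<epsilon>\<^sup>2) = \<delta>" .
  let ?E = "{\<omega>\<in>space M. VaR_lower \<beta> N (\<lambda>i. Z i \<omega>) \<delta> \<le> VaR \<beta> M0 Z0 \<and>
      VaR \<beta> M0 Z0 \<le> VaR_upper \<beta> N (\<lambda>i. Z i \<omega>) \<delta>}"
  let ?G = "\<lambda>\<omega>. emp_cdf N (\<lambda>i. Z i \<omega>)"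
  let ?D = "{\<omega>\<in>space M. \<epsilon> \<le> \<bar>?G \<omega> v - \<beta>\<bar>}"
  have [measurable]: "(\<lambda>\<omega>. ?G \<omega> \<alpha>) \<in> borel_measurable M" for \<alpha>
    using indep by (intro emp_cdf_measurable) (auto simp: indep_vars_def)
  have E_eq: "?E = {\<omega>\<in>space M. (\<forall>q\<in>\<rat>. v < q \<longrightarrow> \<beta> \<le> ?G \<omega> q + \<epsilon>) \<and>
      (\<forall>q\<in>\<rat>. q < v \<longrightarrow> ?G \<omega> q - \<epsilon> < \<beta>)}"
    by (simp add: v VaR_lower_le_iff le_VaR_upper_iff \<epsilon>_def)
  \<comment> \<open>A non-measurable set would have \<open>measure\<close> 0, so this is a genuine
    obligation; the rational form of the event settles it.\<close>
  have E: "?E \<in> events"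
    unfolding E_eq using countable_rat
    by (intro sets.sets_Collect_conj sets.sets_Collect_countable_Ball) measurable
  have "space M - ?D \<subseteq> ?E"
  proof
    fix \<omega> assume "\<omega> \<in> space M - ?D"
    then have \<omega>: "\<omega> \<in> space M" "\<beta> - \<epsilon> < ?G \<omega> v" "?G \<omega> v < \<beta> + \<epsilon>"
      by auto
    \<comment> \<open>The lower estimate at \<open>v\<close> carries over to points on its right,
      the upper one to points on its left.\<close>
    have "\<beta> \<le> ?G \<omega> q + \<epsilon>" if "v < q" for q
      using \<omega> monoD[OF mono_emp_cdf, of v q N "\<lambda>i. Z i \<omega>"] that by simp
    moreover have "?G \<omega> q - \<epsilon> < \<beta>" if "q < v" for q
      using \<omega> monoD[OF mono_emp_cdf, of q v N "\<lambda>i. Z i \<omega>"] that by simp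
    ultimately show "\<omega> \<in> ?E"
      unfolding E_eq using \<omega> by blast
  qed
  then have "prob (space M - ?D) \<le> prob ?E"
    using E by (rule finite_measure_mono)
  moreover have "prob (space M - ?D) = 1 - prob ?D"
    by (rule prob_compl) measurable
  moreover have "prob ?D \<le> 2 * exp (- 2 * real N * \<epsilon>\<^sup>2)"
    using ln_pos by (intro emp_cdf_deviation indep N) (auto simp: distr v \<epsilon>_def)
  ultimately show ?thesis
    using tail by linarith
qed

text \<open>True by construction: these preimages are among the generators of the path
  space.\<close>

lemma borel_measurable_rob_path_space:
  "(\<lambda>x. rob d T m \<phi> x t) \<in> borel_measurable (path_space d T m \<phi> t)"
proof (rule measurableI)
  fix B :: "ereal set" assume "B \<in> sets borel"
  then show "(\<lambda>x. rob d T m \<phi> x t) -` B \<inter> space (path_space d T m \<phi> t)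
      \<in> sets (path_space d T m \<phi> t)"
    unfolding path_space_def by (auto simp: vimage_def intro!: sigma_sets.Basic)
qed simp

theorem proposition1:
  fixes M :: "'w measure" and M' :: "'v measure"
    and X :: "real \<Rightarrow> 'w \<Rightarrow> real ^ 'n" and Y :: "nat \<Rightarrow> real \<Rightarrow> 'v \<Rightarrow> real ^ 'n"
    and d :: "real ^ 'n \<Rightarrow> real ^ 'n \<Rightarrow> real" and \<phi> :: "(real ^ 'n) stl"
    and T :: "real set" and m :: matching and t \<beta> \<delta> :: real and N :: nat
  assumes "Metric_space UNIV d"
    and "T = \<int> \<or> T = UNIV"
    and "m = Nonstrict \<Longrightarrow> T = UNIV"
    and "wf_stl \<phi>"
    and "t \<in> T"
    and "stochastic_process M T X"
    and "rob_rv d T m \<phi> X t \<in> borel_measurable M"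
    and "\<And>\<omega>. \<omega> \<in> space M \<Longrightarrow> \<bar>rob_rv d T m \<phi> X t \<omega>\<bar> \<noteq> \<infinity>"
    and "continuous_on UNIV (cdf (distr M borel (loss d T m \<phi> X t)))"
    and "0 < \<delta>" "\<delta> < 1" "0 < \<beta>" "\<beta> < 1"
    and "N \<ge> 1"
    and "prob_space M'"
    and "independent_copies (path_space d T m \<phi> t) M X M' Y N"
  shows "measure M' {\<omega> \<in> space M'.
      VaR_lower \<beta> N (\<lambda>i. loss d T m \<phi> (Y i) t \<omega>) \<delta> \<le> VaR \<beta> M (loss d T m \<phi> X t) \<and>
      VaR \<beta> M (loss d T m \<phi> X t) \<le> VaR_upper \<beta> N (\<lambda>i. loss d T m \<phi> (Y i) t \<omega>) \<delta>}
    \<ge> 1 - \<delta>"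
proof -
  interpret M: prob_space M
    using assms(6) by (simp add: stochastic_process_def)
  interpret M': prob_space M' by fact
  let ?S = "path_space d T m \<phi> t"
  \<comment> \<open>The losses of \<open>X\<close> and of all copies are this one functional applied
    to the sample paths, so independence and equality in law pass from paths to losses. Since
    \<open>real_of_ereal\<close> sends infinite values to 0, \<open>?g\<close> is defined on every
    path.\<close>
  let ?g = "\<lambda>x. real_of_ereal (- rob d T m \<phi> x t)"
  have g: "?g \<in> borel_measurable ?S"
    using borel_measurable_rob_path_space[of d T m \<phi> t] by measurable
  have loss_eq: "loss d T m \<phi> W t = ?g \<circ> sample_path W" for W :: "real \<Rightarrow> 'z \<Rightarrow> real ^ 'n"
    by (simp add: fun_eq_iff loss_def rob_rv_def sample_path_def)
  have X: "sample_path X \<in> measurable M ?S"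
    using assms(6,7) by (intro measurable_sample_path) (auto simp: stochastic_process_def)
  have indep: "M'.indep_vars (\<lambda>_. ?S) (\<lambda>i. sample_path (Y i)) {1..N}"
    and law: "\<And>i. i \<in> {1..N} \<Longrightarrow> distr M' ?S (sample_path (Y i)) = distr M ?S (sample_path X)"
    using assms(16) by (auto simp: independent_copies_def)
  show ?thesis
  proof (rule M'.VaR_confidence_bounds)
    show "M'.indep_vars (\<lambda>_. borel) (\<lambda>i. loss d T m \<phi> (Y i) t) {1..N}"
      unfolding loss_eq using indep g by (rule M'.indep_vars_compose)
    show "loss d T m \<phi> X t \<in> borel_measurable M"
      unfolding loss_eq using X g by (rule measurable_comp)
    fix i assume i: "i \<in> {1..N}"
    then have "sample_path (Y i) \<in> measurable M' ?S"
      using indep by (auto simp: M'.indep_vars_def)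
    then have "distr M' borel (loss d T m \<phi> (Y i) t) =
        distr (distr M' ?S (sample_path (Y i))) borel ?g"
      using g by (simp add: loss_eq distr_distr)
    also have "\<dots> = distr M borel (loss d T m \<phi> X t)"
      using g X by (simp add: loss_eq law[OF i] distr_distr)
    finally show "distr M' borel (loss d T m \<phi> (Y i) t) = distr M borel (loss d T m \<phi> X t)" .
  qed (use assms M.prob_space_axioms in auto)
qed

end
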